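(* Let $I=I_1+I_2+\dots$ be a homogeneous ideal in $\mathcal{A}_d=\mathbb{C}[z_1,\dots,z_d]$ generated by a set $\{f_1,\dots,f_k\}$ of linear polynomials that is orthonormal with respect to the $H^2$ inner product. For every $n\ge1$, every $g\in I_n$ can be written as $g=a_1f_1+\dots+a_kf_k$, where $a_i\in H_{n-1}$ for $i=1,\dots,k$, in such a way that $a_if_i\perp a_jf_j$ for all $i\ne j$. In particular, $I$ has the stable division property with respect to the $H^2$ norm.
   Context: The $H^2$ inner product on $\mathcal{A}_d$ makes distinct monomials orthogonal with $\|z^\alpha\|^2=\frac{\alpha_1!\cdots\alpha_d!}{|\alpha|!}$; $\perp$ refers to this inner product. $H_n\subset\mathcal{A}_d$ is the space of homogeneous polynomials of degree $n$, and $I_n=I\cap H_n$. "Linear polynomial" means homogeneous polynomial of degree 1. An ideal $I\subseteq\mathcal{A}_d$ has the stable division property (with respect to a norm $\|\cdot\|$) if there are a finite set $\{f_1,\dots,f_k\}\subset I$ generating $I$ and a constant $C$ such that every $h\in I$ can be written $h=a_1f_1+\dots+a_kf_k$ with $a_i\in\mathcal{A}_d$ and $\sum_i\|a_if_i\|^2\le C\|h\|^2$. *)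

theory Defs
  imports Complex_Main "HOL-Library.Poly_Mapping"
begin

text \<open>
  The ring \<open>\<complex>[z\<^sub>1,\<dots>,z\<^sub>d]\<close> is the monoid algebra of finitely supported exponent vectors, the
  variables being indexed by a finite type \<open>'d\<close> with \<open>d = CARD('d)\<close>. The coefficient of the
  monomial \<open>z\<^sup>\<alpha>\<close> in \<open>p\<close> is \<open>Poly_Mapping.lookup p \<alpha>\<close>, and \<open>Poly_Mapping.keys p\<close> is the
  set of the \<open>\<alpha>\<close> for which it is nonzero.
\<close>

type_synonym 'd cpoly = "('d \<Rightarrow>\<^sub>0 nat) \<Rightarrow>\<^sub>0 complex"

definition total_degree :: "('d::finite \<Rightarrow>\<^sub>0 nat) \<Rightarrow> nat" where
  "total_degree \<alpha> = (\<Sum>i\<in>UNIV. Poly_Mapping.lookup \<alpha> i)"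

definition homogeneous :: "nat \<Rightarrow> ('d::finite) cpoly set" where
  "homogeneous n = {p. \<forall>\<alpha>\<in>Poly_Mapping.keys p. total_degree \<alpha> = n}"

subsection \<open>The \<open>H\<^sup>2\<close> inner product\<close>

definition h2_weight :: "('d::finite \<Rightarrow>\<^sub>0 nat) \<Rightarrow> real" where
  "h2_weight \<alpha> = (\<Prod>i\<in>UNIV. fact (Poly_Mapping.lookup \<alpha> i)) / fact (total_degree \<alpha>)"

definition h2_inner :: "('d::finite) cpoly \<Rightarrow> 'd cpoly \<Rightarrow> complex" where
  "h2_inner p q =
    (\<Sum>\<alpha>\<in>Poly_Mapping.keys p.
      Poly_Mapping.lookup p \<alpha> * cnj (Poly_Mapping.lookup q \<alpha>) * complex_of_real (h2_weight \<alpha>))"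

definition h2_norm :: "('d::finite) cpoly \<Rightarrow> real" where
  "h2_norm p = sqrt (Re (h2_inner p p))"

lemma h2_inner_single:
  "h2_inner (Poly_Mapping.single \<alpha> 1) (Poly_Mapping.single \<beta> 1) =
    (if \<alpha> = \<beta> then complex_of_real (h2_weight \<alpha>) else 0)"
  by (simp add: h2_inner_def lookup_single when_def)

subsection \<open>Ideals\<close>

text \<open>Ideals of a commutative ring are its submodules as a module over itself.\<close>

global_interpretation ideal: module "(*) :: 'a::comm_ring_1 \<Rightarrow> 'a \<Rightarrow> 'a"
  by unfold_locales (simp_all add: algebra_simps)

abbreviation ideal :: "'a::comm_ring_1 set \<Rightarrow> bool" where
  "ideal \<equiv> module.subspace (*)"

abbreviation ideal_generated :: "'a::comm_ring_1 set \<Rightarrow> 'a set" where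
  "ideal_generated \<equiv> module.span (*)"

text \<open>\<open>graded_sum m I\<close> is \<open>I\<^sub>m + I\<^bsub>m+1\<^esub> + \<dots>\<close>, where \<open>I\<^sub>n = I \<inter> homogeneous n\<close>.\<close>

definition graded_sum :: "nat \<Rightarrow> ('d::finite) cpoly set \<Rightarrow> 'd cpoly set" where
  "graded_sum m I = {(\<Sum>n=m..N. p n) | N p. \<forall>n\<in>{m..N}. p n \<in> I \<inter> homogeneous n}"

definition homogeneous_ideal :: "('d::finite) cpoly set \<Rightarrow> bool" where
  "homogeneous_ideal I \<longleftrightarrow> ideal I \<and> I = graded_sum 0 I"

definition stable_division_property ::
    "(('d::finite) cpoly \<Rightarrow> real) \<Rightarrow> 'd cpoly set \<Rightarrow> bool" where
  "stable_division_property nrm I \<longleftrightarrow>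
    ideal I \<and>
    (\<exists>F C. finite F \<and> F \<subseteq> I \<and> ideal_generated F = I \<and>
      (\<forall>h\<in>I. \<exists>a :: 'd cpoly \<Rightarrow> 'd cpoly.
        h = (\<Sum>f\<in>F. a f * f) \<and>
        (\<Sum>f\<in>F. (nrm (a f * f))\<^sup>2) \<le> C * (nrm h)\<^sup>2))"

end

theory Submission
  imports Defs
begin

text \<open>For \<open>f\<^sub>i = z\<^sub>i\<close> one would attribute each monomial of \<open>g\<close> to the smallest \<open>i \<le> k\<close> with
  \<open>z\<^sub>i\<close> dividing it, that is, telescope \<open>g\<close> over the substitutions that kill \<open>z\<^sub>1, \<dots>, z\<^sub>j\<close>.
  In general, let \<open>G\<^sub>j\<close> be the image of \<open>g\<close> under the substitution that projects the linear forms
  orthogonally to \<open>f\<^sub>1, \<dots>, f\<^sub>j\<close>. Then \<open>G\<^sub>0 = g\<close>, \<open>G\<^sub>k = 0\<close> for \<open>g\<close> in the ideal, and \<open>f\<^sub>j\<close> divides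
  \<open>G\<^bsub>j-1\<^esub> - G\<^sub>j\<close>. The directional derivative belonging to \<open>f\<^sub>i\<close> vanishes on \<open>G\<^sub>j\<close> for \<open>i \<le> j\<close>, and
  the kernel of this derivative is orthogonal to the multiples of \<open>f\<^sub>i\<close>; so the differences
  are pairwise orthogonal. None of this uses homogeneity of \<open>g\<close>, hence stable division holds
  with constant 1.\<close>

section \<open>Notation and general facts on finitely supported functions\<close>

abbreviation single where "single \<equiv> Poly_Mapping.single"
abbreviation lookup where "lookup \<equiv> Poly_Mapping.lookup"
abbreviation keys where "keys \<equiv> Poly_Mapping.keys"

text \<open>For the ring as a module over itself, this simp rule is associativity from right to left; it
  makes \<open>algebra_simps\<close> loop.\<close>

declare ideal.scale_scale [simp del]

text \<open>Updating at a key outside the support is the same as adding a monomial, so any claim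
  that is additive in \<open>p\<close> needs checking on monomials only. Zero is covered as a
  monomial with coefficient 0.\<close>

lemma poly_mapping_add_induct [case_names single add]:
  fixes p :: "'a \<Rightarrow>\<^sub>0 'b::comm_monoid_add"
  assumes single: "\<And>\<alpha> c. P (single \<alpha> c)"
    and add: "\<And>p q. P p \<Longrightarrow> P q \<Longrightarrow> P (p + q)"
  shows "P p"
proof (induction p rule: update_induct)
  case const
  show ?case using single[of undefined 0] by simp
next
  case (update p \<alpha> c)
  have "Poly_Mapping.update \<alpha> c p = p + single \<alpha> c"
    using update by (intro poly_mapping_eqI)
      (auto simp: lookup_update lookup_add lookup_single when_def in_keys_iff)
  then show ?case using update single add by simp
qed

lemma single_zero_sum: "single 0 (sum c A) = (\<Sum>i\<in>A. single 0 (c i))"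
  for c :: "_ \<Rightarrow> _::comm_monoid_add"
  by (induction A rule: infinite_finite_induct) (auto simp: single_add)

lemma keys_minus_subset:
  fixes p q :: "'a \<Rightarrow>\<^sub>0 'b::ab_group_add"
  shows "keys (p - q) \<subseteq> keys p \<union> keys q"
  by (auto simp: in_keys_iff lookup_minus)

subsection \<open>Homogeneous polynomials\<close>

lemma total_degree_add: "total_degree (\<alpha> + \<beta>) = total_degree \<alpha> + total_degree \<beta>"
  by (simp add: total_degree_def lookup_add sum.distrib)

lemma total_degree_single [simp]: "total_degree (single i n) = n"
  by (simp add: total_degree_def lookup_single when_def)

lemma homogeneous_zero [simp]: "0 \<in> homogeneous n"
  by (simp add: homogeneous_def)

lemma homogeneous_one [simp]: "1 \<in> homogeneous 0"
  by (simp add: homogeneous_def total_degree_def)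

lemma homogeneous_add: "p \<in> homogeneous n \<Longrightarrow> q \<in> homogeneous n \<Longrightarrow> p + q \<in> homogeneous n"
  using keys_add[of p q] by (auto simp: homogeneous_def)

lemma homogeneous_diff: "p \<in> homogeneous n \<Longrightarrow> q \<in> homogeneous n \<Longrightarrow> p - q \<in> homogeneous n"
  using keys_minus_subset[of p q] by (auto simp: homogeneous_def)

lemma homogeneous_sum: "(\<And>i. i \<in> A \<Longrightarrow> p i \<in> homogeneous n) \<Longrightarrow> sum p A \<in> homogeneous n"
  by (induction A rule: infinite_finite_induct) (auto intro: homogeneous_add)

lemma homogeneous_mult:
  "p \<in> homogeneous m \<Longrightarrow> q \<in> homogeneous n \<Longrightarrow> p * q \<in> homogeneous (m + n)"
  using keys_mult[of p q] by (fastforce simp: homogeneous_def total_degree_add)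

lemma homogeneous_single: "total_degree \<alpha> = n \<Longrightarrow> single \<alpha> c \<in> homogeneous n"
  by (simp add: homogeneous_def)

lemma homogeneous_const [simp]: "single 0 c \<in> homogeneous 0"
  by (simp add: homogeneous_single total_degree_def)

lemma homogeneous_power: "p \<in> homogeneous m \<Longrightarrow> p ^ n \<in> homogeneous (n * m)"
  by (induction n) (auto intro: homogeneous_mult)

lemma homogeneous_prod:
  "(\<And>i. i \<in> A \<Longrightarrow> p i \<in> homogeneous (n i)) \<Longrightarrow> prod p A \<in> homogeneous (sum n A)"
  by (induction A rule: infinite_finite_induct)
    (auto intro: homogeneous_mult)

text \<open>Isolates the component of one degree without decomposing \<open>p\<close> completely;
  the quotient argument below compares a single degree only.\<close>

lemma homogeneous_split:
  obtains q r where "p = q + r" "q \<in> homogeneous n" "\<And>\<alpha>. \<alpha> \<in> keys r \<Longrightarrow> total_degree \<alpha> \<noteq> n"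
proof -
  have "\<exists>q r. p = q + r \<and> q \<in> homogeneous n \<and> (\<forall>\<alpha>\<in>keys r. total_degree \<alpha> \<noteq> n)"
  proof (induction p rule: poly_mapping_add_induct)
    case (single \<alpha> c)
    show ?case
    proof (cases "total_degree \<alpha> = n")
      case True
      then have "single \<alpha> c \<in> homogeneous n" by (rule homogeneous_single)
      then show ?thesis by (intro exI[of _ "single \<alpha> c"] exI[of _ 0]) simp
    next
      case False
      then show ?thesis by (intro exI[of _ 0] exI[of _ "single \<alpha> c"]) simp
    qed
  next
    case (add p p')
    then obtain q r q' r' where *: "p = q + r" "q \<in> homogeneous n" "\<forall>\<alpha>\<in>keys r. total_degree \<alpha> \<noteq> n"
      "p' = q' + r'" "q' \<in> homogeneous n" "\<forall>\<alpha>\<in>keys r'. total_degree \<alpha> \<noteq> n" by blast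
    show ?case
    proof (intro exI conjI)
      show "p + p' = (q + q') + (r + r')" using * by simp
      show "q + q' \<in> homogeneous n" using * by (simp add: homogeneous_add)
      show "\<forall>\<alpha>\<in>keys (r + r'). total_degree \<alpha> \<noteq> n" using * keys_add[of r r'] by blast
    qed
  qed
  then show thesis using that by blast
qed

text \<open>Take for \<open>a\<close> the component of \<open>b\<close> in degree
  \<open>n - m\<close>. The rest of \<open>b\<close> times \<open>f\<close> has no monomials of
  degree \<open>n\<close>, yet it is a difference of two polynomials homogeneous of degree
  \<open>n\<close>, hence it is 0. The product is preserved, while \<open>a\<close> itself may
  differ from \<open>b\<close>, for example if \<open>f = 0\<close>.\<close>

lemma homogeneous_quotient:
  assumes "f \<in> homogeneous m" and "b * f \<in> homogeneous n" and "m \<le> n"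
  obtains a where "a \<in> homogeneous (n - m)" and "a * f = b * f"
proof -
  obtain a r where ar: "b = a + r" "a \<in> homogeneous (n - m)"
    and r: "\<And>\<alpha>. \<alpha> \<in> keys r \<Longrightarrow> total_degree \<alpha> \<noteq> n - m"
    by (rule homogeneous_split[of b "n - m"]) blast
  have "a * f \<in> homogeneous n"
    using homogeneous_mult[OF ar(2) assms(1)] assms(3) by simp
  then have "b * f - a * f \<in> homogeneous n"
    using assms(2) by (rule homogeneous_diff[rotated])
  then have "r * f \<in> homogeneous n"
    by (simp add: ar(1) algebra_simps)
  moreover have "total_degree \<alpha> \<noteq> n" if "\<alpha> \<in> keys (r * f)" for \<alpha>
  proof -
    from that keys_mult[of r f] obtain \<beta> \<gamma>
      where "\<alpha> = \<beta> + \<gamma>" "\<beta> \<in> keys r" "\<gamma> \<in> keys f" by blast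
    then show ?thesis
      using r[of \<beta>] assms(1,3) by (auto simp: total_degree_add homogeneous_def)
  qed
  ultimately have "keys (r * f) = {}"
    by (auto simp: homogeneous_def)
  then have "r * f = 0"
    by (intro poly_mapping_eqI) (simp add: in_keys_iff set_eq_iff)
  then show thesis
    using that[of a] ar by (simp add: algebra_simps)
qed

lemma total_degree_eq_1:
  assumes "total_degree \<alpha> = 1"
  shows "\<exists>i. \<alpha> = single i 1"
proof -
  have "\<exists>i. lookup \<alpha> i \<noteq> 0"
  proof (rule ccontr)
    assume "\<nexists>i. lookup \<alpha> i \<noteq> 0"
    then show False using assms by (simp add: total_degree_def)
  qed
  then obtain i where i: "lookup \<alpha> i \<noteq> 0" ..
  have "total_degree \<alpha> = lookup \<alpha> i + (\<Sum>j\<in>UNIV - {i}. lookup \<alpha> j)"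
    by (simp add: total_degree_def sum.remove)
  then have "lookup \<alpha> i = 1" "(\<Sum>j\<in>UNIV - {i}. lookup \<alpha> j) = 0"
    using i assms by linarith+
  then have "\<alpha> = single i 1"
    by (intro poly_mapping_eqI) (auto simp: lookup_single when_def)
  then show ?thesis ..
qed

text \<open>Stated with \<open>Suc 0\<close>, the form into which the simplifier brings the exponent
  1.\<close>

lemma single_Suc_0_eq_iff [simp]: "single i (Suc 0) = single j (Suc 0) \<longleftrightarrow> i = j"
  by (metis lookup_single_eq lookup_single_not_eq nat.distinct(1))

lemma linear_expansion:
  fixes f :: "('d::finite) cpoly"
  assumes "f \<in> homogeneous 1"
  shows "f = (\<Sum>i\<in>UNIV. single (single i 1) (lookup f (single i 1)))"
proof (rule poly_mapping_eqI)
  fix \<alpha>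
  show "lookup f \<alpha> = lookup (\<Sum>i\<in>UNIV. single (single i 1) (lookup f (single i 1))) \<alpha>"
  proof (cases "total_degree \<alpha> = 1")
    case True
    then obtain i where "\<alpha> = single i 1" using total_degree_eq_1 by blast
    then show ?thesis
      by (simp add: lookup_sum lookup_single when_def)
  next
    case False
    then have "lookup f \<alpha> = 0"
      using assms by (auto simp: homogeneous_def in_keys_iff)
    moreover have "lookup (single (single i 1) c) \<alpha> = 0" for i and c :: complex
      using False by (intro lookup_single_not_eq) auto
    ultimately show ?thesis by (simp only: lookup_sum sum.neutral_const)
  qed
qed

subsection \<open>The inner product\<close>

text \<open>The definition sums over the support of the first argument only; a common index set is
  what makes conjugate symmetry visible.\<close>

lemma h2_inner_superset:
  assumes "finite A" "keys p \<subseteq> A"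
  shows "h2_inner p q =
    (\<Sum>\<alpha>\<in>A. lookup p \<alpha> * cnj (lookup q \<alpha>) * complex_of_real (h2_weight \<alpha>))"
  unfolding h2_inner_def
  by (rule sum.mono_neutral_left) (use assms in \<open>auto simp: in_keys_iff\<close>)

lemma h2_inner_add_left: "h2_inner (p + p') q = h2_inner p q + h2_inner p' q"
  unfolding h2_inner_def
  by (rule setsum_keys_plus_distrib) (simp_all add: distrib_right)

lemma h2_inner_zero_left [simp]: "h2_inner 0 q = 0"
  by (simp add: h2_inner_def)

lemma h2_inner_zero_right [simp]: "h2_inner p 0 = 0"
  by (simp add: h2_inner_def)

lemma h2_inner_add_right: "h2_inner p (q + q') = h2_inner p q + h2_inner p q'"
  by (simp add: h2_inner_def lookup_add algebra_simps sum.distrib)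

lemma h2_inner_sum_left: "h2_inner (sum p A) q = (\<Sum>i\<in>A. h2_inner (p i) q)"
  by (induction A rule: infinite_finite_induct) (auto simp: h2_inner_add_left)

lemma h2_inner_sum_right: "h2_inner p (sum q A) = (\<Sum>i\<in>A. h2_inner p (q i))"
  by (induction A rule: infinite_finite_induct) (auto simp: h2_inner_add_right)

lemma h2_inner_cnj: "cnj (h2_inner p q) = h2_inner q p"
proof -
  let ?A = "keys p \<union> keys q"
  have "h2_inner p q = (\<Sum>\<alpha>\<in>?A. lookup p \<alpha> * cnj (lookup q \<alpha>) * complex_of_real (h2_weight \<alpha>))"
    by (rule h2_inner_superset) auto
  moreover have "h2_inner q p = (\<Sum>\<alpha>\<in>?A. lookup q \<alpha> * cnj (lookup p \<alpha>) * complex_of_real (h2_weight \<alpha>))"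
    by (rule h2_inner_superset) auto
  ultimately show ?thesis
    by (simp add: mult.commute)
qed

lemma h2_inner_single_left:
  "h2_inner (single \<alpha> c) q = c * cnj (lookup q \<alpha>) * complex_of_real (h2_weight \<alpha>)"
  by (subst h2_inner_superset[of "{\<alpha>}"]) simp_all

lemma h2_inner_self_nonneg: "Re (h2_inner p p) \<ge> 0"
proof -
  have "h2_weight \<alpha> \<ge> 0" for \<alpha> :: "'a \<Rightarrow>\<^sub>0 nat"
    by (simp add: h2_weight_def prod_nonneg)
  then show ?thesis
    by (simp add: h2_inner_def complex_mult_cnj sum_nonneg flip: of_real_mult of_real_power)
qed

lemma h2_norm_squared: "(h2_norm p)\<^sup>2 = Re (h2_inner p p)"
  by (simp add: h2_norm_def h2_inner_self_nonneg)

text \<open>This ratio of weights is why multiplication by a variable and differentiation are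
  adjoint up to a factor that depends on the degree alone: the factor
  \<open>lookup \<beta> i + 1\<close> is the one produced by differentiating.\<close>

lemma h2_weight_add_single:
  "h2_weight (\<beta> + single i 1) =
    h2_weight \<beta> * real (lookup \<beta> i + 1) / real (total_degree \<beta> + 1)"
proof -
  have "(\<Prod>j\<in>UNIV. fact (lookup (\<beta> + single i 1) j)) =
      (\<Prod>j\<in>UNIV. fact (lookup \<beta> j) * (if j = i then real (lookup \<beta> i + 1) else 1))"
    by (intro prod.cong) (auto simp: lookup_add lookup_single when_def)
  also have "\<dots> = (\<Prod>j\<in>UNIV. fact (lookup \<beta> j)) * real (lookup \<beta> i + 1)"
    by (simp add: prod.distrib)
  finally show ?thesis
    by (simp add: h2_weight_def total_degree_add field_simps)
qed

lemma h2_weight_single [simp]: "h2_weight (single i (Suc 0)) = 1"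
  using h2_weight_add_single[of 0 i] by (simp add: h2_weight_def total_degree_def)

text \<open>In degree 1 all weights are 1, which leaves the standard Hermitian product of the
  coefficient vectors.\<close>

lemma h2_inner_linear:
  assumes "f \<in> homogeneous 1"
  shows "h2_inner f g = (\<Sum>i\<in>UNIV. lookup f (single i 1) * cnj (lookup g (single i 1)))"
proof -
  have "h2_inner f g = h2_inner (\<Sum>i\<in>UNIV. single (single i 1) (lookup f (single i 1))) g"
    using linear_expansion[OF assms] by simp
  then show ?thesis
    by (simp only: h2_inner_sum_left h2_inner_single_left) simp
qed

subsection \<open>Directional derivatives\<close>

text \<open>The subtraction of exponents is truncated. If \<open>z_i\<close> does not divide the
  monomial, the exponent is wrong but the factor \<open>lookup \<alpha> i\<close> is 0, so the term
  vanishes.\<close>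

definition dderiv :: "('d::finite \<Rightarrow> complex) \<Rightarrow> 'd cpoly \<Rightarrow> 'd cpoly" where
  "dderiv v p = (\<Sum>\<alpha>\<in>keys p. \<Sum>i\<in>UNIV.
     single (\<alpha> - single i 1) (v i * of_nat (lookup \<alpha> i) * lookup p \<alpha>))"

lemma dderiv_single:
  "dderiv v (single \<alpha> c) = (\<Sum>i\<in>UNIV. single (\<alpha> - single i 1) (v i * of_nat (lookup \<alpha> i) * c))"
  by (simp add: dderiv_def)

lemma dderiv_zero [simp]: "dderiv v 0 = 0"
  by (simp add: dderiv_def)

lemma dderiv_add: "dderiv v (p + q) = dderiv v p + dderiv v q"
  unfolding dderiv_def
  by (rule setsum_keys_plus_distrib) (simp_all add: distrib_left single_add sum.distrib)

lemma dderiv_diff: "dderiv v (p - q) = dderiv v p - dderiv v q"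
  using dderiv_add[of v "p - q" q] by simp

lemma dderiv_sum: "dderiv v (sum p A) = (\<Sum>i\<in>A. dderiv v (p i))"
  by (induction A rule: infinite_finite_induct) (auto simp: dderiv_add)

lemma dderiv_const [simp]: "dderiv v (single 0 c) = 0"
  by (simp add: dderiv_single)

lemma dderiv_mult: "dderiv v (p * q) = dderiv v p * q + p * dderiv v q"
proof (induction p rule: poly_mapping_add_induct)
  case (single \<alpha> c)
  show ?case
  proof (induction q rule: poly_mapping_add_induct)
    case (single \<beta> d)
    \<comment> \<open>Truncated subtraction commutes with adding \<open>\<beta>\<close> only if
      \<open>lookup \<alpha> i\<close> is nonzero; the factor
      \<open>of_nat (lookup \<alpha> i)\<close> makes both sides 0 otherwise.\<close>
    have shift: "single (\<alpha> - single i 1 + \<beta>) (of_nat (lookup \<alpha> i) * x) =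
        single (\<alpha> + \<beta> - single i 1) (of_nat (lookup \<alpha> i) * x)"
      for \<alpha> \<beta> :: "'a \<Rightarrow>\<^sub>0 nat" and i and x :: complex
    proof (cases "lookup \<alpha> i = 0")
      case False
      then have "\<alpha> - single i 1 + \<beta> = \<alpha> + \<beta> - single i 1"
        by (intro poly_mapping_eqI) (auto simp: lookup_add lookup_minus lookup_single when_def)
      then show ?thesis by simp
    qed simp
    have "single (\<alpha> + \<beta> - single i 1) (v i * of_nat (lookup (\<alpha> + \<beta>) i) * (c * d)) =
        single (\<alpha> - single i 1) (v i * of_nat (lookup \<alpha> i) * c) * single \<beta> d +
        single \<alpha> c * single (\<beta> - single i 1) (v i * of_nat (lookup \<beta> i) * d)" for i
    proof -
      have "v i * of_nat (lookup (\<alpha> + \<beta>) i) * (c * d) =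
          of_nat (lookup \<alpha> i) * (v i * c * d) + of_nat (lookup \<beta> i) * (v i * c * d)"
        by (simp add: lookup_add algebra_simps)
      moreover have "single (\<alpha> - single i 1) (v i * of_nat (lookup \<alpha> i) * c) * single \<beta> d =
          single (\<alpha> + \<beta> - single i 1) (of_nat (lookup \<alpha> i) * (v i * c * d))"
        unfolding shift[symmetric] by (simp add: mult_single mult_ac add.commute)
      moreover have "single \<alpha> c * single (\<beta> - single i 1) (v i * of_nat (lookup \<beta> i) * d) =
          single (\<alpha> + \<beta> - single i 1) (of_nat (lookup \<beta> i) * (v i * c * d))"
        unfolding add.commute[of \<alpha> \<beta>] shift[symmetric]
        by (simp add: mult_single mult_ac add.commute)
      ultimately show ?thesis by (simp only: single_add)
    qed
    then show ?case
      by (simp add: mult_single dderiv_single sum_distrib_left sum_distrib_right sum.distrib)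
  next
    case (add p q)
    then show ?case by (simp add: dderiv_add algebra_simps)
  qed
next
  case (add p q)
  then show ?case by (simp add: dderiv_add algebra_simps)
qed

lemma lookup_dderiv:
  "lookup (dderiv v p) \<beta> =
    (\<Sum>i\<in>UNIV. v i * of_nat (lookup \<beta> i + 1) * lookup p (\<beta> + single i 1))"
proof (induction p rule: poly_mapping_add_induct)
  case (single \<alpha> c)
  \<comment> \<open>A monomial reaches \<open>\<beta>\<close> through the i-th partial derivative
    exactly if it is \<open>\<beta> + single i 1\<close>. For \<open>lookup \<alpha> i = 0\<close>
    truncation breaks this equivalence, but then both contributions vanish.\<close>
  have "\<alpha> - single i 1 = \<beta> \<longleftrightarrow> \<alpha> = \<beta> + single i 1" if "lookup \<alpha> i \<noteq> 0" for i
    using that by (auto simp: poly_mapping_eq_iff fun_eq_iff lookup_add lookup_minus lookup_single when_def)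
  moreover have "\<alpha> \<noteq> \<beta> + single i 1" if "lookup \<alpha> i = 0" for i
    using that by (auto simp: lookup_add)
  ultimately have "lookup (single (\<alpha> - single i 1) (v i * of_nat (lookup \<alpha> i) * c)) \<beta> =
      v i * of_nat (lookup \<beta> i + 1) * lookup (single \<alpha> c) (\<beta> + single i 1)" for i
    by (cases "lookup \<alpha> i = 0") (auto simp: lookup_single when_def lookup_add)
  then show ?case by (simp add: dderiv_single lookup_sum)
next
  case (add p q)
  then show ?case by (simp add: dderiv_add lookup_add algebra_simps sum.distrib)
qed

text \<open>The conjugation makes the derivative of a linear form \<open>g\<close> in this direction
  the constant \<open>h2_inner g f\<close>, so orthogonality of linear forms becomes vanishing of a
  derivative.\<close>

definition conj_coeffs :: "('d::finite) cpoly \<Rightarrow> 'd \<Rightarrow> complex" where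
  "conj_coeffs f i = cnj (lookup f (single i 1))"

lemma dderiv_var: "dderiv v (single (single i 1) c) = single 0 (v i * c)"
proof -
  have "dderiv v (single (single i 1) c) = (\<Sum>j\<in>UNIV. if j = i then single 0 (v i * c) else 0)"
    unfolding dderiv_single by (intro sum.cong) (auto simp: lookup_single when_def)
  then show ?thesis by simp
qed

lemma dderiv_conj_coeffs:
  assumes "g \<in> homogeneous 1"
  shows "dderiv (conj_coeffs f) g = single 0 (h2_inner g f)"
proof -
  have "dderiv (conj_coeffs f) g =
      (\<Sum>i\<in>UNIV. dderiv (conj_coeffs f) (single (single i 1) (lookup g (single i 1))))"
    using linear_expansion[OF assms] by (metis dderiv_sum)
  then show ?thesis
    by (simp only: h2_inner_linear[OF assms] dderiv_var single_zero_sum conj_coeffs_def mult.commute)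
qed

text \<open>Up to the factor \<open>1 / (|\<beta>| + 1)\<close> on \<open>z\<^sup>\<beta>\<close>, the derivative in the conjugate direction is the
  \<open>H\<^sup>2\<close>-adjoint of multiplication by a linear form.\<close>

lemma h2_inner_mult_linear_eq_0:
  assumes f: "f \<in> homogeneous 1" and q: "dderiv (conj_coeffs f) q = 0"
  shows "h2_inner (p * f) q = 0"
proof (induction p rule: poly_mapping_add_induct)
  case (single \<beta> c)
  have "single \<beta> c * f = (\<Sum>i\<in>UNIV. single (\<beta> + single i 1) (c * lookup f (single i 1)))"
    by (subst linear_expansion[OF f]) (simp add: sum_distrib_left mult_single)
  then have "h2_inner (single \<beta> c * f) q =
      (\<Sum>i\<in>UNIV. c * lookup f (single i 1) * cnj (lookup q (\<beta> + single i 1)) *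
        (h2_weight \<beta> * (lookup \<beta> i + 1) / (total_degree \<beta> + 1)))"
    by (simp only: h2_inner_sum_left h2_inner_single_left h2_weight_add_single)
  also have "\<dots> = c * h2_weight \<beta> / (total_degree \<beta> + 1) * cnj (lookup (dderiv (conj_coeffs f) q) \<beta>)"
    unfolding lookup_dderiv cnj_sum sum_distrib_left
    by (intro sum.cong) (simp_all add: conj_coeffs_def)
  finally show ?case using q by simp
next
  case (add p q)
  then show ?case by (simp add: distrib_right h2_inner_add_left)
qed

subsection \<open>Substitution\<close>

definition poly_subst :: "('d::finite \<Rightarrow> 'd cpoly) \<Rightarrow> 'd cpoly \<Rightarrow> 'd cpoly" where
  "poly_subst y p = (\<Sum>\<alpha>\<in>keys p. single 0 (lookup p \<alpha>) * (\<Prod>i\<in>UNIV. y i ^ lookup \<alpha> i))"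

lemma poly_subst_single:
  "poly_subst y (single \<alpha> c) = single 0 c * (\<Prod>i\<in>UNIV. y i ^ lookup \<alpha> i)"
  by (simp add: poly_subst_def)

lemma poly_subst_add: "poly_subst y (p + q) = poly_subst y p + poly_subst y q"
  unfolding poly_subst_def
  by (rule setsum_keys_plus_distrib) (simp_all add: distrib_right single_add)

lemma poly_subst_zero [simp]: "poly_subst y 0 = 0"
  by (simp add: poly_subst_def)

lemma poly_subst_sum: "poly_subst y (sum p A) = (\<Sum>i\<in>A. poly_subst y (p i))"
  by (induction A rule: infinite_finite_induct) (auto simp: poly_subst_add)

lemma poly_subst_mult: "poly_subst y (p * q) = poly_subst y p * poly_subst y q"
proof (induction p rule: poly_mapping_add_induct)
  case (single \<alpha> c)
  show ?case
  proof (induction q rule: poly_mapping_add_induct)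
    case (single \<beta> d)
    have const: "single 0 (c * d) = single 0 c * single (0 :: 'a \<Rightarrow>\<^sub>0 nat) d"
      by (simp add: mult_single)
    show ?case
      unfolding mult_single[of \<alpha>] poly_subst_single const
      by (simp add: lookup_add power_add prod.distrib mult_ac)
  qed (simp add: poly_subst_add algebra_simps)
qed (simp add: poly_subst_add algebra_simps)

lemma poly_subst_var: "poly_subst y (single (single i 1) c) = single 0 c * y i"
proof -
  have "(\<Prod>j\<in>UNIV. y j ^ lookup (single i 1) j) = (\<Prod>j\<in>UNIV. if j = i then y i else 1)"
    by (intro prod.cong) (auto simp: lookup_single when_def)
  then show ?thesis by (simp add: poly_subst_single)
qed

lemma poly_subst_id: "poly_subst (\<lambda>i. single (single i 1) 1) p = p"
proof (induction p rule: poly_mapping_add_induct)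
  case (single \<alpha> c)
  have pow: "single (single i (Suc 0)) (1::complex) ^ n = single (single i n) 1" for i :: 'a and n
    by (induction n) (simp_all add: mult_single flip: single_add)
  have "(\<Prod>i\<in>A. single (single i (lookup \<alpha> i)) (1::complex)) =
      single (\<Sum>i\<in>A. single i (lookup \<alpha> i)) 1" for A
    by (induction A rule: infinite_finite_induct) (simp_all add: mult_single)
  moreover have "(\<Sum>i\<in>UNIV. single i (lookup \<alpha> i)) = \<alpha>"
    by (intro poly_mapping_eqI) (simp add: lookup_sum lookup_single when_def)
  ultimately show ?case by (simp add: poly_subst_single pow mult_single)
qed (simp add: poly_subst_add)

lemma poly_subst_homogeneous:
  assumes "\<And>i. y i \<in> homogeneous 1" "p \<in> homogeneous n"
  shows "poly_subst y p \<in> homogeneous n"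
  unfolding poly_subst_def
proof (rule homogeneous_sum)
  fix \<alpha> assume "\<alpha> \<in> keys p"
  then have "total_degree \<alpha> = n" using assms(2) by (simp add: homogeneous_def)
  \<comment> \<open>The factor 1 is the degree of \<open>y i\<close>, kept so that the sum has the
    shape that \<open>homogeneous_power\<close> produces.\<close>
  moreover have "(\<Prod>i\<in>UNIV. y i ^ lookup \<alpha> i) \<in> homogeneous (\<Sum>i\<in>UNIV. lookup \<alpha> i * 1)"
    by (intro homogeneous_prod homogeneous_power assms)
  ultimately show "single 0 (lookup p \<alpha>) * (\<Prod>i\<in>UNIV. y i ^ lookup \<alpha> i) \<in> homogeneous n"
    using homogeneous_mult[OF homogeneous_const[of "lookup p \<alpha>"]] by (simp add: total_degree_def)
qed

text \<open>Congruence modulo \<open>x\<close> is compatible with multiplication.\<close>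

lemma dvd_diff_mult:
  fixes a b c d x :: "'a::comm_ring_1"
  assumes "x dvd a - b" "x dvd c - d"
  shows "x dvd a * c - b * d"
proof -
  have "a * c - b * d = (a - b) * c + b * (c - d)" by (simp add: algebra_simps)
  then show ?thesis using assms by (metis dvd_add dvd_mult dvd_mult2)
qed

text \<open>Congruence modulo \<open>x\<close> passes from the substituted values to their powers,
  products and linear combinations.\<close>

lemma dvd_poly_subst_diff:
  assumes "\<And>i. x dvd y i - y' i"
  shows "x dvd poly_subst y p - poly_subst y' p"
proof -
  have pow: "x dvd y i ^ n - y' i ^ n" for i n
    by (induction n) (auto intro: dvd_diff_mult assms)
  have "x dvd (\<Prod>i\<in>A. y i ^ lookup \<alpha> i) - (\<Prod>i\<in>A. y' i ^ lookup \<alpha> i)" for A and \<alpha> :: "'a \<Rightarrow>\<^sub>0 nat"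
    by (induction A rule: infinite_finite_induct) (auto intro: dvd_diff_mult pow)
  then show ?thesis
    unfolding poly_subst_def sum_subtractf[symmetric] right_diff_distrib[symmetric]
    by (intro dvd_sum dvd_mult)
qed

text \<open>By the product rule the kernel of a derivation is a subring; it contains the constants
  and all \<open>y i\<close>.\<close>

lemma dderiv_poly_subst_eq_0:
  assumes "\<And>i. dderiv v (y i) = 0"
  shows "dderiv v (poly_subst y p) = 0"
proof -
  have one: "dderiv v 1 = 0" using dderiv_const[of v 1] by simp
  have pow: "dderiv v (y i ^ n) = 0" for i n
    by (induction n) (simp_all add: dderiv_mult assms one)
  have "dderiv v (\<Prod>i\<in>A. y i ^ lookup \<alpha> i) = 0" for A and \<alpha> :: "'a \<Rightarrow>\<^sub>0 nat"
    by (induction A rule: infinite_finite_induct) (simp_all add: dderiv_mult pow one)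
  then show ?thesis
    by (simp add: poly_subst_def dderiv_sum dderiv_mult)
qed

subsection \<open>Ideals generated by orthonormal linear forms\<close>

text \<open>The degree claim concerns the products \<open>a i * f i\<close> and is conditional on
  \<open>g\<close> being homogeneous, so that one decomposition serves both the graded statement and
  stable division of arbitrary elements.\<close>

lemma orthonormal_linear_decomposition:
  fixes f :: "nat \<Rightarrow> ('d::finite) cpoly"
  assumes lin: "\<And>i. i \<in> {1..k} \<Longrightarrow> f i \<in> homogeneous 1"
    and orth: "\<And>i j. i \<in> {1..k} \<Longrightarrow> j \<in> {1..k} \<Longrightarrow> h2_inner (f i) (f j) = (if i = j then 1 else 0)"
    and g: "g \<in> ideal_generated (f ` {1..k})"
  obtains a where "g = (\<Sum>i=1..k. a i * f i)"
    and "\<And>i j. i \<in> {1..k} \<Longrightarrow> j \<in> {1..k} \<Longrightarrow> i \<noteq> j \<Longrightarrow> h2_inner (a i * f i) (a j * f j) = 0"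
    and "\<And>i n. i \<in> {1..k} \<Longrightarrow> g \<in> homogeneous n \<Longrightarrow> a i * f i \<in> homogeneous n"
proof -
  define x :: "'d \<Rightarrow> 'd cpoly" where "x i = single (single i 1) 1" for i
  \<comment> \<open>The coefficient \<open>conj_coeffs (f l) i\<close> is the inner product of
    \<open>x i\<close> with \<open>f l\<close>, as in Gram-Schmidt. For \<open>j = 0\<close> the sum
    is empty and the substitution is the identity.\<close>
  define y where "y j i = x i - (\<Sum>l=1..j. single 0 (conj_coeffs (f l) i) * f l)" for j i
  define G where "G j = poly_subst (y j) g" for j
  have x_lin: "x i \<in> homogeneous 1" for i
    by (simp add: x_def homogeneous_single)
  have y_lin: "y j i \<in> homogeneous 1" if "j \<le> k" for i j
    unfolding y_def
  proof (intro homogeneous_diff homogeneous_sum x_lin)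
    fix l assume "l \<in> {1..j}"
    then show "single 0 (conj_coeffs (f l) i) * f l \<in> homogeneous 1"
      using homogeneous_mult[of _ 0 "f l" 1] lin[of l] \<open>j \<le> k\<close> by simp
  qed
  have dy: "dderiv (conj_coeffs (f l)) (y j i) = 0" if "1 \<le> l" "l \<le> j" "j \<le> k" for l j i
  proof -
    have "dderiv (conj_coeffs (f l)) (x i) = single 0 (conj_coeffs (f l) i)"
      unfolding x_def dderiv_var by simp
    moreover have "dderiv (conj_coeffs (f l)) (single 0 (conj_coeffs (f m) i) * f m) =
        (if m = l then single 0 (conj_coeffs (f l) i) else 0)" if "m \<in> {1..j}" for m
    proof -
      have "l \<in> {1..k}" "m \<in> {1..k}"
        using that \<open>1 \<le> l\<close> \<open>l \<le> j\<close> \<open>j \<le> k\<close> by auto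
      then show ?thesis
        by (simp only: dderiv_mult dderiv_conj_coeffs lin orth) simp
    qed
    ultimately show ?thesis
      using that by (simp add: y_def dderiv_diff dderiv_sum)
  qed
  have "G 0 = g"
    unfolding G_def y_def x_def by (simp add: poly_subst_id[simplified])
  \<comment> \<open>On linear forms the substitution is the projection itself: \<open>f l\<close>
    goes to \<open>f l\<close> minus its expansion in the orthonormal family, which is again
    \<open>f l\<close>.\<close>
  have "poly_subst (y k) (f l) = 0" if l: "l \<in> {1..k}" for l
  proof -
    define c where "c i = lookup (f l) (single i 1)" for i
    have f_eq: "f l = (\<Sum>i\<in>UNIV. single (single i 1) (c i))"
      unfolding c_def using lin[OF l] by (rule linear_expansion)
    have "poly_subst (y k) (f l) = (\<Sum>i\<in>UNIV. single 0 (c i) * y k i)"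
      by (subst f_eq) (simp only: poly_subst_sum poly_subst_var)
    also have "\<dots> = (\<Sum>i\<in>UNIV. single 0 (c i) * x i) -
        (\<Sum>m=1..k. (\<Sum>i\<in>UNIV. single 0 (c i * conj_coeffs (f m) i)) * f m)"
      unfolding y_def right_diff_distrib sum_subtractf sum_distrib_left sum_distrib_right
      by (subst (2) sum.swap) (simp add: mult_single flip: mult.assoc)
    also have "(\<Sum>i\<in>UNIV. single 0 (c i) * x i) = f l"
      unfolding f_eq x_def by (simp add: mult_single)
    also have "(\<Sum>m=1..k. (\<Sum>i\<in>UNIV. single 0 (c i * conj_coeffs (f m) i)) * f m) =
        (\<Sum>m=1..k. single 0 (h2_inner (f l) (f m)) * f m)"
      by (simp add: h2_inner_linear[OF lin[OF l]] single_zero_sum c_def conj_coeffs_def)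
    also have "\<dots> = (\<Sum>m=1..k. if m = l then f l else 0)"
      using l by (intro sum.cong) (auto simp: orth)
    also have "\<dots> = f l" using l by simp
    finally show ?thesis by simp
  qed
  \<comment> \<open>The kernel of a ring homomorphism is an ideal, so killing the generators
    suffices.\<close>
  moreover have "ideal {p. poly_subst (y k) p = 0}"
    by (rule ideal.subspaceI) (simp_all add: poly_subst_add poly_subst_mult)
  ultimately have "ideal_generated (f ` {1..k}) \<subseteq> {p. poly_subst (y k) p = 0}"
    by (intro ideal.span_minimal) auto
  then have "G k = 0" using g by (auto simp: G_def)
  have "f i dvd G (i - 1) - G i" if "i \<in> {1..k}" for i
    unfolding G_def
  proof (rule dvd_poly_subst_diff)
    fix m
    \<comment> \<open>The two sums differ only in the summand \<open>l = i\<close>; since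
      \<open>i\<close> is at least 1, \<open>i - 1\<close> is a true predecessor.\<close>
    have "y (i - 1) m - y i m = single 0 (conj_coeffs (f i) m) * f i"
      using that by (cases i) (simp_all add: y_def)
    then show "f i dvd y (i - 1) m - y i m" by simp
  qed
  then have "\<forall>i\<in>{1..k}. \<exists>b. G (i - 1) - G i = b * f i"
    by (metis dvdE mult.commute)
  then obtain a where a: "\<And>i. i \<in> {1..k} \<Longrightarrow> G (i - 1) - G i = a i * f i"
    by metis
  have "(\<Sum>i=1..m. G (i - 1) - G i) = G 0 - G m" for m
    by (induction m) simp_all
  from this[of k] have "g = (\<Sum>i=1..k. G (i - 1) - G i)"
    using \<open>G 0 = g\<close> \<open>G k = 0\<close> by simp
  also have "\<dots> = (\<Sum>i=1..k. a i * f i)"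
    by (intro sum.cong refl a)
  finally have sum_eq: "g = (\<Sum>i=1..k. a i * f i)" .
  have orth_less: "h2_inner (a i * f i) (a j * f j) = 0" if "1 \<le> i" "i < j" "j \<le> k" for i j
  proof (rule h2_inner_mult_linear_eq_0)
    show "f i \<in> homogeneous 1" using that by (intro lin) auto
    \<comment> \<open>From \<open>i < j\<close> both \<open>j - 1\<close> and \<open>j\<close> are
      at least \<open>i\<close>, so the derivative along \<open>f i\<close> kills both terms of
      \<open>G (j - 1) - G j\<close>.\<close>
    have "dderiv (conj_coeffs (f i)) (G m) = 0" if "i \<le> m" "m \<le> k" for m
      unfolding G_def using that \<open>1 \<le> i\<close> by (intro dderiv_poly_subst_eq_0 dy)
    then have "dderiv (conj_coeffs (f i)) (G (j - 1) - G j) = 0"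
      using that by (simp add: dderiv_diff)
    then show "dderiv (conj_coeffs (f i)) (a j * f j) = 0"
      using that a[of j] by simp
  qed
  show thesis
  proof (rule that[of a])
    show "g = (\<Sum>i=1..k. a i * f i)" by (rule sum_eq)
    show "h2_inner (a i * f i) (a j * f j) = 0" if "i \<in> {1..k}" "j \<in> {1..k}" "i \<noteq> j" for i j
    proof (cases "i < j")
      case True
      then show ?thesis using that by (intro orth_less) auto
    next
      case False
      then have "h2_inner (a j * f j) (a i * f i) = 0" using that by (intro orth_less) auto
      then show ?thesis by (metis h2_inner_cnj complex_cnj_zero)
    qed
    show "a i * f i \<in> homogeneous n" if i: "i \<in> {1..k}" and g: "g \<in> homogeneous n" for i n
    proof -
      have "G m \<in> homogeneous n" if "m \<le> k" for m
        unfolding G_def using y_lin[OF that] g by (rule poly_subst_homogeneous)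
      then show ?thesis
        unfolding a[OF i, symmetric] using i by (intro homogeneous_diff) auto
    qed
  qed
qed

text \<open>Pythagoras; for the terms of the decomposition it turns the stable division bound into
  an equality.\<close>

lemma h2_norm_squared_orthogonal_sum:
  assumes "finite A" "\<And>i j. i \<in> A \<Longrightarrow> j \<in> A \<Longrightarrow> i \<noteq> j \<Longrightarrow> h2_inner (p i) (p j) = 0"
  shows "(h2_norm (\<Sum>i\<in>A. p i))\<^sup>2 = (\<Sum>i\<in>A. (h2_norm (p i))\<^sup>2)"
proof -
  have "h2_inner (\<Sum>i\<in>A. p i) (\<Sum>j\<in>A. p j) = (\<Sum>i\<in>A. \<Sum>j\<in>A. h2_inner (p i) (p j))"
    by (simp only: h2_inner_sum_left) (simp only: h2_inner_sum_right)
  also have "\<dots> = (\<Sum>i\<in>A. \<Sum>j\<in>A. if j = i then h2_inner (p i) (p i) else 0)"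
    using assms(2) by (intro sum.cong) auto
  also have "\<dots> = (\<Sum>i\<in>A. h2_inner (p i) (p i))"
    using assms(1) by simp
  finally show ?thesis
    by (simp add: h2_norm_squared)
qed

theorem proposition2p1:
  fixes I :: "('d::finite) cpoly set" and f :: "nat \<Rightarrow> 'd cpoly" and k :: nat
  assumes "homogeneous_ideal I"
    and "I = graded_sum 1 I"
    and "\<forall>i\<in>{1..k}. f i \<in> homogeneous 1"
    and "\<forall>i\<in>{1..k}. \<forall>j\<in>{1..k}. h2_inner (f i) (f j) = (if i = j then 1 else 0)"
    and "ideal_generated (f ` {1..k}) = I"
  shows "(\<forall>n\<ge>1. \<forall>g \<in> I \<inter> homogeneous n.
            \<exists>a :: nat \<Rightarrow> 'd cpoly.
              (\<forall>i\<in>{1..k}. a i \<in> homogeneous (n - 1)) \<and>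
              g = (\<Sum>i=1..k. a i * f i) \<and>
              (\<forall>i\<in>{1..k}. \<forall>j\<in>{1..k}. i \<noteq> j \<longrightarrow> h2_inner (a i * f i) (a j * f j) = 0))
       \<and> stable_division_property h2_norm I"
proof
  have lin: "\<And>i. i \<in> {1..k} \<Longrightarrow> f i \<in> homogeneous 1"
    and orth: "\<And>i j. i \<in> {1..k} \<Longrightarrow> j \<in> {1..k} \<Longrightarrow> h2_inner (f i) (f j) = (if i = j then 1 else 0)"
    using assms(3,4) by blast+
  have decomposition: "\<exists>a. h = (\<Sum>i=1..k. a i * f i) \<and>
      (\<forall>i\<in>{1..k}. \<forall>j\<in>{1..k}. i \<noteq> j \<longrightarrow> h2_inner (a i * f i) (a j * f j) = 0) \<and>
      (\<forall>i\<in>{1..k}. \<forall>n. h \<in> homogeneous n \<longrightarrow> a i * f i \<in> homogeneous n)" if "h \<in> I" for h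
  proof -
    have h: "h \<in> ideal_generated (f ` {1..k})" using that assms(5) by simp
    show ?thesis
    proof (rule orthonormal_linear_decomposition[of k f h])
      fix a
      assume "h = (\<Sum>i=1..k. a i * f i)"
        and "\<And>i j. i \<in> {1..k} \<Longrightarrow> j \<in> {1..k} \<Longrightarrow> i \<noteq> j \<Longrightarrow> h2_inner (a i * f i) (a j * f j) = 0"
        and "\<And>i n. i \<in> {1..k} \<Longrightarrow> h \<in> homogeneous n \<Longrightarrow> a i * f i \<in> homogeneous n"
      then show ?thesis by (intro exI[of _ a] conjI) blast+
    qed (fact lin orth h)+
  qed
  show "\<forall>n\<ge>1. \<forall>g \<in> I \<inter> homogeneous n.
            \<exists>a :: nat \<Rightarrow> 'd cpoly.
              (\<forall>i\<in>{1..k}. a i \<in> homogeneous (n - 1)) \<and>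
              g = (\<Sum>i=1..k. a i * f i) \<and>
              (\<forall>i\<in>{1..k}. \<forall>j\<in>{1..k}. i \<noteq> j \<longrightarrow> h2_inner (a i * f i) (a j * f j) = 0)"
  proof (intro allI impI ballI)
    fix n g assume n: "1 \<le> (n::nat)" and g: "g \<in> I \<inter> homogeneous n"
    obtain b where b: "g = (\<Sum>i=1..k. b i * f i)"
      "\<And>i j. i \<in> {1..k} \<Longrightarrow> j \<in> {1..k} \<Longrightarrow> i \<noteq> j \<Longrightarrow> h2_inner (b i * f i) (b j * f j) = 0"
      "\<And>i. i \<in> {1..k} \<Longrightarrow> b i * f i \<in> homogeneous n"
      using decomposition[of g] g by blast
    \<comment> \<open>Only the products enter the sum and the orthogonality relations, so each
      \<open>b i\<close> may be exchanged for a homogeneous factor with the same product.\<close>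
    have "\<exists>c\<in>homogeneous (n - 1). c * f i = b i * f i" if "i \<in> {1..k}" for i
      using homogeneous_quotient[OF lin[OF that] b(3)[OF that] n] by metis
    then obtain a where a: "\<And>i. i \<in> {1..k} \<Longrightarrow> a i \<in> homogeneous (n - 1)"
      "\<And>i. i \<in> {1..k} \<Longrightarrow> a i * f i = b i * f i"
      by metis
    show "\<exists>a. (\<forall>i\<in>{1..k}. a i \<in> homogeneous (n - 1)) \<and>
        g = (\<Sum>i=1..k. a i * f i) \<and>
        (\<forall>i\<in>{1..k}. \<forall>j\<in>{1..k}. i \<noteq> j \<longrightarrow> h2_inner (a i * f i) (a j * f j) = 0)"
      using a(1) b(1,2) by (intro exI[of _ a]) (simp add: a(2))
  qed
  \<comment> \<open>If \<open>f i = f j\<close> with distinct indices, the same inner product would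
    be both 1 and 0. Stable division sums over the set of generators, so each index must account for
    exactly one term.\<close>
  have inj: "inj_on f {1..k}"
    using orth by (intro inj_onI) (metis zero_neq_one)
  show "stable_division_property h2_norm I"
    unfolding stable_division_property_def
  proof (intro conjI exI[of _ "f ` {1..k}"] exI[of _ "1::real"] ballI)
    show "ideal I" using assms(1) by (simp add: homogeneous_ideal_def)
    show "finite (f ` {1..k})" by simp
    show "f ` {1..k} \<subseteq> I" using assms(5) ideal.span_superset by blast
    show "ideal_generated (f ` {1..k}) = I" by (rule assms(5))
    fix h assume "h \<in> I"
    then obtain a where a: "h = (\<Sum>i=1..k. a i * f i)"
      "\<And>i j. i \<in> {1..k} \<Longrightarrow> j \<in> {1..k} \<Longrightarrow> i \<noteq> j \<Longrightarrow> h2_inner (a i * f i) (a j * f j) = 0"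
      using decomposition[of h] by blast
    \<comment> \<open>Stable division indexes coefficients by the generators themselves; the inverse
      of \<open>f\<close> carries them over from the indices.\<close>
    define a' where "a' = a \<circ> inv_into {1..k} f"
    \<comment> \<open>Stated for an arbitrary \<open>F\<close> in order to serve both for the sum of
      polynomials and for the sum of squared norms.\<close>
    have reindex: "(\<Sum>p\<in>f ` {1..k}. F (a' p * p)) = (\<Sum>i=1..k. F (a i * f i))"
      for F :: "'d cpoly \<Rightarrow> 'b::comm_monoid_add"
      unfolding sum.reindex[OF inj] by (intro sum.cong) (simp_all only: a'_def o_apply inv_into_f_f[OF inj])
    show "\<exists>a. h = (\<Sum>p\<in>f ` {1..k}. a p * p) \<and>
        (\<Sum>p\<in>f ` {1..k}. (h2_norm (a p * p))\<^sup>2) \<le> 1 * (h2_norm h)\<^sup>2"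
    proof (intro exI conjI)
      show "h = (\<Sum>p\<in>f ` {1..k}. a' p * p)"
        using reindex[of "\<lambda>p. p"] a(1) by simp
      show "(\<Sum>p\<in>f ` {1..k}. (h2_norm (a' p * p))\<^sup>2) \<le> 1 * (h2_norm h)\<^sup>2"
        using reindex[of "\<lambda>p. (h2_norm p)\<^sup>2"] h2_norm_squared_orthogonal_sum[of "{1..k}" "\<lambda>i. a i * f i"] a
        by simp
    qed
  qed
qed

end
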